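(* Let $\mathcal{G}$ be a position independent generalized Cops and Robbers game with round summary digraph $\mathcal{R}_{\mathcal{G}}$. The Pursuer has a winning strategy in $\mathcal{G}$ if and only if $\mathcal{R}_{\mathcal{G}}$ admits a removable vertex ordering.
   Context: A position independent generalized Cops and Robbers game $\mathcal{G}$ is a discrete-time, perfect-information game between a Pursuer and an Evader, as follows. There are finite sets $\mathcal{P}_P$ and $\mathcal{P}_E$ of allowed positions for the Pursuer and the Evader; the set of positions is $\mathcal{P}_P\times\mathcal{P}_E$. At each position not in the set $\mathcal{F}$ below, the non-empty set of moves available to a player does not depend on the position of the other player, so the moves are described by two digraphs (loops allowed), the position digraphs $G_P=(\mathcal{P}_P,\mathcal{M}_P)$ and $G_E=(\mathcal{P}_E,\mathcal{M}_E)$: when the position is $(p_P,q_E)$ and it is the Pursuer's turn, he moves to some $w_P\in N^+_{G_P}(p_P)$ (new position $(w_P,q_E)$), and when it is the Evader's turn, she moves to some $x_E\in N^+_{G_E}(q_E)$ (new position $(p_P,x_E)$). Here $N^+_G(u)$ is the set of out-neighbours of $u$ in $G$; all these sets are non-empty. There is a set $\mathcal{I}\subseteq\mathcal{P}_P\times\mathcal{P}_E$ of allowed start positions. The game begins with the Pursuer choosing $p_P$ in $\mathcal{I}_P=\{p_P : (p_P,q_E)\in\mathcal{I}\text{ for some }q_E\}$ and then the Evader choosing $q_E$ in $\mathcal{I}_E(p_P)=\{q_E : (p_P,q_E)\in\mathcal{I}\}$; thereafter the players move alternately, the Pursuer first. There is a set $\mathcal{F}\subseteq\mathcal{P}_P\times\mathcal{P}_E$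 of final positions. The Pursuer wins if at any time-step the current position belongs to $\mathcal{F}$; otherwise the Evader wins. The Pursuer has a winning strategy if he can choose his start position and subsequent moves (depending on the play so far) so that he wins regardless of the Evader's choices. The round summary digraph is the categorical product $\mathcal{R}_{\mathcal{G}}=G_P\times G_E$: its vertex set is $\mathcal{P}_P\times\mathcal{P}_E$, with a directed edge from $(a,b)$ to $(c,d)$ whenever $(a,c)\in E(G_P)$ and $(b,d)\in E(G_E)$. A vertex $(p_P,q_E)$ of $\mathcal{R}_{\mathcal{G}}$ is removable with respect to $X\subseteq V(\mathcal{R}_{\mathcal{G}})$ if either (1) $(p_P,q_E)\in\mathcal{F}$, or (2) for every $x_E\in N^+_{G_E}(q_E)$, either $(p_P,x_E)\in\mathcal{F}$ or there exists $y_P\in N^+_{G_P}(p_P)$ such that $(y_P,x_E)\in X$. A removable vertex ordering for $\mathcal{R}_{\mathcal{G}}$ is a (finite) sequence of vertices of $\mathcal{R}_{\mathcal{G}}$, not necessarily including all vertices, in which each element $(p_P,q_E)$ is removable with respect to the set $X$ of vertices that precede it in the sequence, and such that there exists $p_P\in\mathcal{I}_P$ so that, for all $q_E\in\mathcal{I}_E(p_P)$, either $(p_P,q_E)\in\mathcal{F}$ or there exists $w_P\in N^+_{G_P}(p_P)$ such that $(w_P,q_E)$ belongs to the sequence. *)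

theory Defs
  imports "Graph_Theory.Pair_Digraph"
begin

definition out_nbrs :: "'a pair_pre_digraph \<Rightarrow> 'a \<Rightarrow> 'a set" where
  "out_nbrs D u = {v. (u, v) \<in> parcs D}"

text \<open>The allowed positions of a player are the vertices of that player's position digraph.\<close>

record ('p, 'e) cr_game =
  pursuer_digraph :: "'p pair_pre_digraph"
  evader_digraph :: "'e pair_pre_digraph"
  start_positions :: "('p \<times> 'e) set"
  final_positions :: "('p \<times> 'e) set"

definition positions :: "('p, 'e) cr_game \<Rightarrow> ('p \<times> 'e) set" where
  "positions G = pverts (pursuer_digraph G) \<times> pverts (evader_digraph G)"

text \<open>Loops are allowed: the library's \<^locale>\<open>pair_fin_digraph\<close>, unlike
  \<^locale>\<open>pair_digraph\<close>, does not exclude them.\<close>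

locale position_independent_game =
  pursuer: pair_fin_digraph "pursuer_digraph G" + evader: pair_fin_digraph "evader_digraph G"
  for G :: "('p, 'e) cr_game" +
  assumes pursuer_can_move: "p \<in> pverts (pursuer_digraph G) \<Longrightarrow> out_nbrs (pursuer_digraph G) p \<noteq> {}"
    and evader_can_move: "q \<in> pverts (evader_digraph G) \<Longrightarrow> out_nbrs (evader_digraph G) q \<noteq> {}"
    and start_positions_subset: "start_positions G \<subseteq> positions G"
    and final_positions_subset: "final_positions G \<subseteq> positions G"

definition pursuer_starts :: "('p, 'e) cr_game \<Rightarrow> 'p set" where
  "pursuer_starts G = {p. \<exists>q. (p, q) \<in> start_positions G}"

definition evader_starts :: "('p, 'e) cr_game \<Rightarrow> 'p \<Rightarrow> 'e set" where
  "evader_starts G p = {q. (p, q) \<in> start_positions G}"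


text \<open>A play is recorded as the sequence of positions, beginning with the start position. Turns
  are counted from 0, and the Pursuer moves on the even ones. Plays run forever; passing through a
  final position decides the game, so whatever follows it is irrelevant.\<close>

definition legal_move :: "('p, 'e) cr_game \<Rightarrow> nat \<Rightarrow> 'p \<times> 'e \<Rightarrow> 'p \<times> 'e \<Rightarrow> bool" where
  "legal_move G i v w \<longleftrightarrow>
     (if even i then fst w \<in> out_nbrs (pursuer_digraph G) (fst v) \<and> snd w = snd v
      else fst w = fst v \<and> snd w \<in> out_nbrs (evader_digraph G) (snd v))"

definition partial_play :: "('p, 'e) cr_game \<Rightarrow> ('p \<times> 'e) list \<Rightarrow> bool" where
  "partial_play G h \<longleftrightarrow> h \<noteq> [] \<and> hd h \<in> start_positions G \<and>
     (\<forall>i. Suc i < length h \<longrightarrow> legal_move G i (h ! i) (h ! Suc i))"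

definition play :: "('p, 'e) cr_game \<Rightarrow> (nat \<Rightarrow> 'p \<times> 'e) \<Rightarrow> bool" where
  "play G \<pi> \<longleftrightarrow> \<pi> 0 \<in> start_positions G \<and> (\<forall>i. legal_move G i (\<pi> i) (\<pi> (Suc i)))"

text \<open>A strategy maps the play so far to the Pursuer's next position. It is the Pursuer's turn
  exactly when the number of positions seen so far is odd. Requiring a legal answer to every partial
  play keeps a strategy from winning vacuously by admitting no consistent play.\<close>

definition pursuer_strategy :: "('p, 'e) cr_game \<Rightarrow> (('p \<times> 'e) list \<Rightarrow> 'p) \<Rightarrow> bool" where
  "pursuer_strategy G \<sigma> \<longleftrightarrow>
     (\<forall>h. partial_play G h \<and> odd (length h) \<longrightarrow>
        \<sigma> h \<in> out_nbrs (pursuer_digraph G) (fst (last h)))"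

definition follows_strategy :: "(('p \<times> 'e) list \<Rightarrow> 'p) \<Rightarrow> (nat \<Rightarrow> 'p \<times> 'e) \<Rightarrow> bool" where
  "follows_strategy \<sigma> \<pi> \<longleftrightarrow>
     (\<forall>i. even i \<longrightarrow> fst (\<pi> (Suc i)) = \<sigma> (map \<pi> [0..<Suc i]))"

definition pursuer_wins_play :: "('p, 'e) cr_game \<Rightarrow> (nat \<Rightarrow> 'p \<times> 'e) \<Rightarrow> bool" where
  "pursuer_wins_play G \<pi> \<longleftrightarrow> (\<exists>i. \<pi> i \<in> final_positions G)"

definition pursuer_has_winning_strategy :: "('p, 'e) cr_game \<Rightarrow> bool" where
  "pursuer_has_winning_strategy G \<longleftrightarrow>
     (\<exists>p \<in> pursuer_starts G. \<exists>\<sigma>. pursuer_strategy G \<sigma> \<and>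
        (\<forall>\<pi>. play G \<pi> \<and> fst (\<pi> 0) = p \<and> follows_strategy \<sigma> \<pi> \<longrightarrow> pursuer_wins_play G \<pi>))"


definition categorical_product ::
  "'a pair_pre_digraph \<Rightarrow> 'b pair_pre_digraph \<Rightarrow> ('a \<times> 'b) pair_pre_digraph" where
  "categorical_product D E =
     \<lparr> pverts = pverts D \<times> pverts E,
       parcs = {((a, b), (c, d)) | a b c d. (a, c) \<in> parcs D \<and> (b, d) \<in> parcs E} \<rparr>"

definition round_summary_digraph :: "('p, 'e) cr_game \<Rightarrow> ('p \<times> 'e) pair_pre_digraph" where
  "round_summary_digraph G = categorical_product (pursuer_digraph G) (evader_digraph G)"

definition removable :: "('p, 'e) cr_game \<Rightarrow> ('p \<times> 'e) set \<Rightarrow> 'p \<times> 'e \<Rightarrow> bool" where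
  "removable G X v \<longleftrightarrow>
     v \<in> final_positions G \<or>
     (\<forall>x \<in> out_nbrs (evader_digraph G) (snd v).
        (fst v, x) \<in> final_positions G \<or>
        (\<exists>y \<in> out_nbrs (pursuer_digraph G) (fst v). (y, x) \<in> X))"

definition removable_vertex_ordering :: "('p, 'e) cr_game \<Rightarrow> ('p \<times> 'e) list \<Rightarrow> bool" where
  "removable_vertex_ordering G vs \<longleftrightarrow>
     set vs \<subseteq> pverts (round_summary_digraph G) \<and>
     (\<forall>i < length vs. removable G (set (take i vs)) (vs ! i)) \<and>
     (\<exists>p \<in> pursuer_starts G. \<forall>q \<in> evader_starts G p.
        (p, q) \<in> final_positions G \<or>
        (\<exists>w \<in> out_nbrs (pursuer_digraph G) p. (w, q) \<in> set vs))"

end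

theory Submission
  imports Defs
begin

text \<open>
  The elements of a removable vertex ordering are positions, seen with the Evader to move, from
  which the Pursuer wins; the place of a position in the ordering is a ranking function. At an
  element \<open>v\<close>, unless \<open>v\<close> is final, every move of the Evader either ends the game or leaves the
  Pursuer an answer that leads to a strictly earlier element. The Pursuer therefore wins by always
  moving to a position of least rank. This strategy looks only at the current position,
  and since ranks cannot decrease forever, every play following it meets a final position
  (\<open>pursuer_wins_if_ordering\<close>).

  For the converse, as there are only finitely many positions, some sequence of successively
  removable vertices is saturated: every position that is removable with respect to its set \<open>W\<close>
  of elements already lies in \<open>W\<close> (\<open>saturated_removal_sequence\<close>). A position outside \<open>W\<close> is then
  not final, and the Evader has a move from it to a non-final position from which the Pursuer cannot
  enter \<open>W\<close>. If the sequence is not a removable vertex ordering, then every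
  start of the Pursuer allows the Evader a start of this latter kind, so against any
  strategy she can stay away from the final positions forever (\<open>ordering_if_pursuer_wins\<close>).
\<close>

section \<open>Legal play stays among the positions\<close>

context position_independent_game
begin

lemma legal_move_positions:
  assumes "legal_move G i v w" "v \<in> positions G"
  shows "w \<in> positions G"
  using assms
  by (auto simp: legal_move_def positions_def out_nbrs_def mem_Times_iff
      dest: pursuer.in_arcsD2 evader.in_arcsD2 split: if_splits)

lemma partial_play_nth_positions:
  assumes "partial_play G h" "i < length h"
  shows "h ! i \<in> positions G"
  using assms(2)
proof (induction i)
  case 0
  then show ?case
    using assms(1) start_positions_subset by (auto simp: partial_play_def hd_conv_nth)
next
  case (Suc i)
  then show ?case
    using assms(1) legal_move_positions[of i "h ! i"] by (auto simp: partial_play_def)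
qed

lemma partial_play_last_positions:
  assumes "partial_play G h"
  shows "last h \<in> positions G"
  using assms partial_play_nth_positions[OF assms, of "length h - 1"]
  by (auto simp: partial_play_def last_conv_nth)

lemma partial_play_snoc:
  assumes "partial_play G h" "length h = Suc n" "legal_move G n (last h) w"
  shows "partial_play G (h @ [w])"
proof -
  have "legal_move G i ((h @ [w]) ! i) ((h @ [w]) ! Suc i)" if "Suc i < length (h @ [w])" for i
  proof (cases "i = n")
    case True
    moreover have "h ! n = last h"
      using assms(2) by (metis diff_Suc_1 last_conv_nth length_0_conv nat.distinct(1))
    ultimately show ?thesis
      using assms by (simp add: nth_append)
  next
    case False
    then show ?thesis
      using that assms by (simp add: nth_append partial_play_def)
  qed
  then show ?thesis
    using assms(1) by (simp add: partial_play_def)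
qed

end

section \<open>Removal sequences\<close>

definition removal_sequence :: "('p, 'e) cr_game \<Rightarrow> ('p \<times> 'e) list \<Rightarrow> bool" where
  "removal_sequence G vs \<longleftrightarrow>
     set vs \<subseteq> positions G \<and> (\<forall>i < length vs. removable G (set (take i vs)) (vs ! i))"

definition pursuer_can_enter :: "('p, 'e) cr_game \<Rightarrow> ('p \<times> 'e) set \<Rightarrow> 'p \<times> 'e \<Rightarrow> bool" where
  "pursuer_can_enter G X v \<longleftrightarrow> (\<exists>y \<in> out_nbrs (pursuer_digraph G) (fst v). (y, snd v) \<in> X)"

lemma removable_iff:
  "removable G X v \<longleftrightarrow> v \<in> final_positions G \<or>
     (\<forall>x \<in> out_nbrs (evader_digraph G) (snd v).
        (fst v, x) \<in> final_positions G \<or> pursuer_can_enter G X (fst v, x))"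
  by (simp add: removable_def pursuer_can_enter_def)

lemma removable_vertex_ordering_iff:
  "removable_vertex_ordering G vs \<longleftrightarrow> removal_sequence G vs \<and>
     (\<exists>p \<in> pursuer_starts G. \<forall>q \<in> evader_starts G p.
        (p, q) \<in> final_positions G \<or> pursuer_can_enter G (set vs) (p, q))"
  by (simp add: removable_vertex_ordering_def removal_sequence_def pursuer_can_enter_def
      round_summary_digraph_def categorical_product_def positions_def conj_assoc)

lemma removal_sequence_snoc:
  assumes "removal_sequence G vs" "v \<in> positions G" "removable G (set vs) v"
  shows "removal_sequence G (vs @ [v])"
  using assms by (auto simp: removal_sequence_def nth_append less_Suc_eq)

text \<open>A removal sequence with the greatest possible number of distinct elements is saturated,
  because a further removable vertex could be appended to it.\<close>

lemma (in position_independent_game) saturated_removal_sequence: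
  obtains vs where "removal_sequence G vs"
    and "\<And>v. v \<in> positions G \<Longrightarrow> removable G (set vs) v \<Longrightarrow> v \<in> set vs"
proof -
  have fin: "finite (positions G)"
    by (simp add: positions_def)
  have "removal_sequence G []"
    by (simp add: removal_sequence_def)
  moreover have "\<forall>vs. removal_sequence G vs \<longrightarrow> card (set vs) < Suc (card (positions G))"
    using fin by (auto simp: removal_sequence_def less_Suc_eq_le card_mono)
  ultimately obtain vs where vs: "removal_sequence G vs"
    and max: "\<And>us. removal_sequence G us \<Longrightarrow> card (set us) \<le> card (set vs)"
    using ex_has_greatest_nat[of "removal_sequence G" "[]" "\<lambda>vs. card (set vs)"] by blast
  have "v \<in> set vs" if "v \<in> positions G" "removable G (set vs) v" for v
  proof (rule ccontr)
    assume "v \<notin> set vs"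
    then show False
      using max[OF removal_sequence_snoc[OF vs that]] by simp
  qed
  with vs show ?thesis
    by (rule that)
qed

section \<open>A removable vertex ordering gives a winning strategy\<close>

text \<open>The index of the first occurrence of \<open>v\<close>; elements outside the list get its length, so
  that they rank behind all its elements.\<close>

definition rank :: "'a list \<Rightarrow> 'a \<Rightarrow> nat" where
  "rank vs v = length (takeWhile (\<lambda>u. u \<noteq> v) vs)"

lemma rank_less_if_in_take:
  assumes "v \<in> set (take i vs)"
  shows "rank vs v < i"
proof -
  obtain j where j: "j < i" "j < length vs" "vs ! j = v"
    using assms by (auto simp: in_set_conv_nth)
  have "\<not> j < rank vs v"
  proof
    assume "j < rank vs v"
    then have "takeWhile (\<lambda>u. u \<noteq> v) vs ! j \<in> set (takeWhile (\<lambda>u. u \<noteq> v) vs)"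
      by (simp add: rank_def)
    moreover have "takeWhile (\<lambda>u. u \<noteq> v) vs ! j = v"
      using \<open>j < rank vs v\<close> j by (simp add: rank_def takeWhile_nth)
    ultimately show False
      by (auto dest: set_takeWhileD)
  qed
  with j show ?thesis by simp
qed

lemma nth_rank:
  assumes "rank vs v < length vs"
  shows "vs ! rank vs v = v"
  using nth_length_takeWhile[of "\<lambda>u. u \<noteq> v" vs] assms by (simp add: rank_def)

lemma rank_less_length_iff: "rank vs v < length vs \<longleftrightarrow> v \<in> set vs"
  using rank_less_if_in_take[of v "length vs" vs] nth_rank[of vs v] nth_mem[of "rank vs v" vs]
  by auto

definition least_rank_strategy ::
  "('p, 'e) cr_game \<Rightarrow> ('p \<times> 'e) list \<Rightarrow> ('p \<times> 'e) list \<Rightarrow> 'p" where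
  "least_rank_strategy G vs h =
     arg_min (\<lambda>y. rank vs (y, snd (last h)))
       (\<lambda>y. y \<in> out_nbrs (pursuer_digraph G) (fst (last h)))"

context position_independent_game
begin

lemma pursuer_strategy_least_rank: "pursuer_strategy G (least_rank_strategy G vs)"
  unfolding pursuer_strategy_def least_rank_strategy_def
proof (intro allI impI)
  fix h assume "partial_play G h \<and> odd (length h)"
  then have "fst (last h) \<in> pverts (pursuer_digraph G)"
    using partial_play_last_positions[of h] by (auto simp: positions_def)
  then obtain y where "y \<in> out_nbrs (pursuer_digraph G) (fst (last h))"
    using pursuer_can_move by blast
  then show "arg_min (\<lambda>y. rank vs (y, snd (last h)))
      (\<lambda>y. y \<in> out_nbrs (pursuer_digraph G) (fst (last h)))
    \<in> out_nbrs (pursuer_digraph G) (fst (last h))"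
    by (rule arg_min_natI)
qed

lemma least_rank_move:
  assumes "play G \<pi>" "follows_strategy (least_rank_strategy G vs) \<pi>" "even i"
    and "pursuer_can_enter G (set (take k vs)) (\<pi> i)"
  shows "rank vs (\<pi> (Suc i)) < k"
proof -
  obtain y where y: "y \<in> out_nbrs (pursuer_digraph G) (fst (\<pi> i))"
    and "(y, snd (\<pi> i)) \<in> set (take k vs)"
    using assms(4) by (auto simp: pursuer_can_enter_def)
  then have less: "rank vs (y, snd (\<pi> i)) < k"
    by (auto intro: rank_less_if_in_take)
  have "fst (\<pi> (Suc i)) = least_rank_strategy G vs (map \<pi> [0..<Suc i])"
    using assms(2,3) by (simp add: follows_strategy_def)
  moreover have "snd (\<pi> (Suc i)) = snd (\<pi> i)"
    using assms(1,3) by (simp add: play_def legal_move_def)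
  ultimately have "\<pi> (Suc i) = (arg_min (\<lambda>y. rank vs (y, snd (\<pi> i)))
      (\<lambda>y. y \<in> out_nbrs (pursuer_digraph G) (fst (\<pi> i))), snd (\<pi> i))"
    by (simp add: least_rank_strategy_def prod_eq_iff)
  then have "rank vs (\<pi> (Suc i)) \<le> rank vs (y, snd (\<pi> i))"
    using arg_min_nat_le[of "\<lambda>y. y \<in> out_nbrs (pursuer_digraph G) (fst (\<pi> i))" y
        "\<lambda>y. rank vs (y, snd (\<pi> i))"] y by simp
  with less show ?thesis by simp
qed

text \<open>The position after a move of the Pursuer is removable with respect to the elements of smaller
  rank, so whatever the Evader does, one of these is within reach at the Pursuer's next move unless
  she has entered a final position.\<close>

lemma rank_decreases:
  assumes "removal_sequence G vs" "play G \<pi>" "follows_strategy (least_rank_strategy G vs) \<pi>"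
    and "\<not> pursuer_wins_play G \<pi>" "odd i" "\<pi> i \<in> set vs"
  shows "rank vs (\<pi> (Suc (Suc i))) < rank vs (\<pi> i)"
proof -
  have "rank vs (\<pi> i) < length vs"
    using assms(6) by (simp add: rank_less_length_iff)
  then have "removable G (set (take (rank vs (\<pi> i)) vs)) (\<pi> i)"
    using assms(1) nth_rank[of vs "\<pi> i"] by (metis removal_sequence_def)
  moreover have "fst (\<pi> (Suc i)) = fst (\<pi> i)"
    and "snd (\<pi> (Suc i)) \<in> out_nbrs (evader_digraph G) (snd (\<pi> i))"
    using assms(2,5) by (simp_all add: play_def legal_move_def)
  moreover have "\<pi> i \<notin> final_positions G" "\<pi> (Suc i) \<notin> final_positions G"
    using assms(4) by (auto simp: pursuer_wins_play_def)
  ultimately have "pursuer_can_enter G (set (take (rank vs (\<pi> i)) vs)) (\<pi> (Suc i))"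
    by (metis removable_iff prod.collapse)
  then show ?thesis
    using least_rank_move assms(2,3,5) by simp
qed

lemma pursuer_wins_if_ordering:
  assumes "removable_vertex_ordering G vs"
  shows "pursuer_has_winning_strategy G"
proof -
  have seq: "removal_sequence G vs"
    using assms by (simp add: removable_vertex_ordering_iff)
  obtain p where p: "p \<in> pursuer_starts G"
    and start: "\<And>q. q \<in> evader_starts G p \<Longrightarrow>
      (p, q) \<in> final_positions G \<or> pursuer_can_enter G (set vs) (p, q)"
    using assms by (auto simp: removable_vertex_ordering_iff)
  have "pursuer_wins_play G \<pi>"
    if \<pi>: "play G \<pi>" "fst (\<pi> 0) = p" "follows_strategy (least_rank_strategy G vs) \<pi>" for \<pi>
  proof (rule ccontr)
    assume nwin: "\<not> pursuer_wins_play G \<pi>"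
    let ?r = "\<lambda>n. rank vs (\<pi> (Suc (2 * n)))"
    have step: "?r (Suc n) < ?r n" if "?r n < length vs" for n
      using rank_decreases[OF seq \<pi>(1,3) nwin, of "Suc (2 * n)"] that
      by (simp add: rank_less_length_iff)
    have bounded: "?r n < length vs" for n
    proof (induction n)
      case 0
      have "snd (\<pi> 0) \<in> evader_starts G p"
        using \<pi>(1,2) by (auto simp: play_def evader_starts_def)
      moreover have "\<pi> 0 \<notin> final_positions G"
        using nwin by (auto simp: pursuer_wins_play_def)
      ultimately have "pursuer_can_enter G (set (take (length vs) vs)) (\<pi> 0)"
        using start \<pi>(2) by fastforce
      then show ?case
        using least_rank_move[OF \<pi>(1,3), of 0 "length vs"] by simp
    next
      case (Suc n)
      then show ?case
        using step[of n] by simp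
    qed
    have "\<forall>n. (?r (Suc n), ?r n) \<in> {(x, y). x < y}"
      using step bounded by simp
    then have "\<exists>f :: nat \<Rightarrow> nat. \<forall>n. (f (Suc n), f n) \<in> {(x, y). x < y}"
      by (rule exI[of _ ?r])
    then show False
      by (rule notE[OF wf_less[unfolded wf_iff_no_infinite_down_chain]])
  qed
  then show ?thesis
    using p pursuer_strategy_least_rank by (auto simp: pursuer_has_winning_strategy_def)
qed

end

section \<open>A winning strategy gives a removable vertex ordering\<close>

text \<open>What the Evader wants of the position after \<open>n\<close> moves, \<open>W\<close> being the set of elements of
  a saturated removal sequence. Elements of \<open>W\<close> are lost for her when it is her turn, so at the
  Pursuer's turns the danger is that he can enter \<open>W\<close>.\<close>

definition evader_safe :: "('p, 'e) cr_game \<Rightarrow> ('p \<times> 'e) set \<Rightarrow> nat \<Rightarrow> 'p \<times> 'e \<Rightarrow> bool" where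
  "evader_safe G W n v \<longleftrightarrow> v \<notin> final_positions G \<and>
     (if even n then \<not> pursuer_can_enter G W v else v \<notin> W)"

context position_independent_game
begin

text \<open>Final positions are removable, hence in the saturated \<open>W\<close>; so a Pursuer who cannot
  enter \<open>W\<close> cannot enter a final position either. A safe position on the Evader's turn is not
  removable, and the negation of the second removability condition is the existence of a
  safe reply.\<close>

lemma evader_safe_step:
  assumes saturated: "\<And>v. v \<in> positions G \<Longrightarrow> removable G W v \<Longrightarrow> v \<in> W"
    and "pursuer_strategy G \<sigma>" "partial_play G h" "length h = Suc n" "evader_safe G W n (last h)"
  obtains w where "legal_move G n (last h) w" "even n \<longrightarrow> fst w = \<sigma> h" "evader_safe G W (Suc n) w"
proof (cases "even n")
  case True
  let ?w = "(\<sigma> h, snd (last h))"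
  have move: "\<sigma> h \<in> out_nbrs (pursuer_digraph G) (fst (last h))"
    using assms(2-4) True by (simp add: pursuer_strategy_def)
  then have legal: "legal_move G n (last h) ?w"
    using True by (simp add: legal_move_def)
  then have "?w \<in> positions G"
    using legal_move_positions partial_play_last_positions[OF assms(3)] by blast
  moreover have "?w \<notin> W"
    using assms(5) True move by (auto simp: evader_safe_def pursuer_can_enter_def)
  ultimately have "?w \<notin> W" "?w \<notin> final_positions G"
    using saturated[of ?w] by (auto simp: removable_iff)
  then have "evader_safe G W (Suc n) ?w"
    using True by (simp add: evader_safe_def)
  with legal show ?thesis
    using that[of ?w] by simp
next
  case False
  then have "\<not> removable G W (last h)"
    using assms(5) saturated[of "last h"] partial_play_last_positions[OF assms(3)]
    by (auto simp: evader_safe_def)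
  then obtain x where "x \<in> out_nbrs (evader_digraph G) (snd (last h))"
    "(fst (last h), x) \<notin> final_positions G" "\<not> pursuer_can_enter G W (fst (last h), x)"
    by (auto simp: removable_iff)
  then show ?thesis
    using that[of "(fst (last h), x)"] False by (simp add: legal_move_def evader_safe_def)
qed

lemma evader_escapes:
  assumes saturated: "\<And>v. v \<in> positions G \<Longrightarrow> removable G W v \<Longrightarrow> v \<in> W"
    and "pursuer_strategy G \<sigma>" "v \<in> start_positions G" "evader_safe G W 0 v"
  obtains \<pi> where "play G \<pi>" "\<pi> 0 = v" "follows_strategy \<sigma> \<pi>" "\<not> pursuer_wins_play G \<pi>"
proof -
  \<comment> \<open>Strategies see the whole history, so the play is built as a chain of growing histories.\<close>
  let ?P = "\<lambda>n h. partial_play G h \<and> length h = Suc n \<and> hd h = v \<and> evader_safe G W n (last h)"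
  let ?Q = "\<lambda>n h h'. \<exists>w. h' = h @ [w] \<and> legal_move G n (last h) w \<and> (even n \<longrightarrow> fst w = \<sigma> h)"
  have "\<exists>H. \<forall>n. ?P n (H n) \<and> ?Q n (H n) (H (Suc n))"
  proof (rule dependent_nat_choice)
    show "\<exists>h. ?P 0 h"
      using assms(3,4) by (intro exI[of _ "[v]"]) (simp add: partial_play_def)
  next
    fix h n assume h: "?P n h"
    then obtain w where w: "legal_move G n (last h) w" "even n \<longrightarrow> fst w = \<sigma> h"
      "evader_safe G W (Suc n) w"
      using evader_safe_step[OF saturated assms(2), of h n] by blast
    have "?P (Suc n) (h @ [w]) \<and> ?Q n h (h @ [w])"
      using h w partial_play_snoc[of h n w] by (auto simp: hd_append)
    then show "\<exists>h'. ?P (Suc n) h' \<and> ?Q n h h'" ..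
  qed
  then obtain H where P: "\<And>n. ?P n (H n)" and Q: "\<And>n. ?Q n (H n) (H (Suc n))"
    by blast
  define \<pi> where "\<pi> n = last (H n)" for n
  have H0: "H 0 = [v]"
    using P[of 0] by (cases "H 0") auto
  have ext: "H (Suc n) = H n @ [\<pi> (Suc n)]" "legal_move G n (\<pi> n) (\<pi> (Suc n))"
    "even n \<longrightarrow> fst (\<pi> (Suc n)) = \<sigma> (H n)" for n
    using Q[of n] by (auto simp: \<pi>_def)
  have history: "map \<pi> [0..<Suc n] = H n" for n
  proof (induction n)
    case 0
    then show ?case
      by (simp add: H0 \<pi>_def)
  next
    case (Suc n)
    then show ?case
      by (simp add: ext(1))
  qed
  show ?thesis
  proof (rule that)
    show start: "\<pi> 0 = v"
      by (simp add: \<pi>_def H0)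
    show "play G \<pi>"
      using assms(3) start ext(2) by (simp add: play_def)
    show "follows_strategy \<sigma> \<pi>"
      unfolding follows_strategy_def history using ext(3) by blast
    show "\<not> pursuer_wins_play G \<pi>"
      using P by (auto simp: pursuer_wins_play_def evader_safe_def \<pi>_def)
  qed
qed

lemma ordering_if_pursuer_wins:
  assumes "pursuer_has_winning_strategy G"
  shows "\<exists>vs. removable_vertex_ordering G vs"
proof -
  obtain vs where seq: "removal_sequence G vs"
    and saturated: "\<And>v. v \<in> positions G \<Longrightarrow> removable G (set vs) v \<Longrightarrow> v \<in> set vs"
    using saturated_removal_sequence by blast
  obtain p \<sigma> where p: "p \<in> pursuer_starts G" and \<sigma>: "pursuer_strategy G \<sigma>"
    and wins: "\<And>\<pi>. play G \<pi> \<Longrightarrow> fst (\<pi> 0) = p \<Longrightarrow> follows_strategy \<sigma> \<pi> \<Longrightarrow> pursuer_wins_play G \<pi>"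
    using assms by (auto simp: pursuer_has_winning_strategy_def)
  have "(p, q) \<in> final_positions G \<or> pursuer_can_enter G (set vs) (p, q)"
    if "q \<in> evader_starts G p" for q
  proof (rule ccontr)
    assume "\<not> ?thesis"
    then have safe: "evader_safe G (set vs) 0 (p, q)"
      by (simp add: evader_safe_def)
    have "(p, q) \<in> start_positions G"
      using that by (simp add: evader_starts_def)
    then obtain \<pi> where "play G \<pi>" "\<pi> 0 = (p, q)" "follows_strategy \<sigma> \<pi>" "\<not> pursuer_wins_play G \<pi>"
      using evader_escapes[OF saturated \<sigma> _ safe] by blast
    with wins show False by simp
  qed
  with seq p show ?thesis
    by (auto simp: removable_vertex_ordering_iff)
qed

end

section \<open>The characterisation\<close>

theorem corollary6:
  fixes G :: "('p, 'e) cr_game"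
  assumes "position_independent_game G"
  shows "pursuer_has_winning_strategy G \<longleftrightarrow> (\<exists>vs. removable_vertex_ordering G vs)"
  using position_independent_game.pursuer_wins_if_ordering[OF assms]
    position_independent_game.ordering_if_pursuer_wins[OF assms] by blast

end
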